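(* Let $G$ be a connected double graph. Then the unique Eulerian orientation $O$ of $G$ minimizing $\mathrm{arb}(O)$ among all Eulerian orientations of $G$ is the symmetric orientation.
   Context: Graphs here are finite, loopless, and may have multiple edges. A graph $G$ is a double graph if there is an even number of edges between any two vertices. The symmetric orientation of a double graph $G$ is the orientation in which, for each pair of vertices $u,v$, half of the edges between $u$ and $v$ are oriented toward $u$ and half of them toward $v$. Parallel edges are regarded as interchangeable, so an orientation is determined by the numbers $m(u,v)$ of edges directed from $u$ to $v$. An orientation is Eulerian if every vertex has equal in-degree and out-degree. An arborescence of a directed graph $D$ rooted at a vertex $v$ is a spanning tree of $D$ in which every vertex different from $v$ has out-degree $1$ and $v$ has out-degree $0$ (every edge is oriented towards the root); parallel edges are counted as distinct. $\mathrm{arb}(D,v)$ is the number of arborescences of $D$ rooted at $v$; for an Eulerian digraph $D$ it does not depend on $v$ and is denoted $\mathrm{arb}(D)$. *)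

theory Defs
  imports "Graph_Theory.Digraph_Component"
begin

text \<open>
  A finite loopless multigraph is given by its vertex set \<open>V\<close> and its edge multiplicities:
  \<open>e u v\<close> is the number of edges between \<open>u\<close> and \<open>v\<close>.
\<close>

locale multigraph =
  fixes V :: "'v set" and e :: "'v \<Rightarrow> 'v \<Rightarrow> nat"
  assumes finite_vertices: "finite V"
    and mult_sym: "e u v = e v u"
    and no_loops: "e u u = 0"
    and edge_in_vertices: "e u v \<noteq> 0 \<Longrightarrow> u \<in> V"

locale double_graph = multigraph +
  assumes even_mult: "even (e u v)"

definition connected_multigraph :: "'v set \<Rightarrow> ('v \<Rightarrow> 'v \<Rightarrow> nat) \<Rightarrow> bool" where
  "connected_multigraph V e \<longleftrightarrow>
     V \<noteq> {} \<and> (\<forall>u\<in>V. \<forall>v\<in>V. (u, v) \<in> {(x, y). e x y \<noteq> 0}\<^sup>*)"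

text \<open>
  Parallel edges are interchangeable, so an orientation is the function \<open>m\<close> for which
  \<open>m u v\<close> is the number of edges directed from \<open>u\<close> to \<open>v\<close>.
  For a multigraph on \<open>V\<close> this forces \<open>m\<close> to vanish outside \<open>V \<times> V\<close>, so that equality of
  orientations is equality of functions.
\<close>

definition orientation :: "('v \<Rightarrow> 'v \<Rightarrow> nat) \<Rightarrow> ('v \<Rightarrow> 'v \<Rightarrow> nat) \<Rightarrow> bool" where
  "orientation e m \<longleftrightarrow> (\<forall>u v. m u v + m v u = e u v)"

definition symmetric_orientation :: "('v \<Rightarrow> 'v \<Rightarrow> nat) \<Rightarrow> 'v \<Rightarrow> 'v \<Rightarrow> nat" where
  "symmetric_orientation e = (\<lambda>u v. e u v div 2)"

text \<open>
  The third component of an arc numbers the parallel arcs, which have to be distinguished when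
  arborescences are counted.
\<close>

definition multi_digraph ::
  "'v set \<Rightarrow> ('v \<Rightarrow> 'v \<Rightarrow> nat) \<Rightarrow> ('v, 'v \<times> 'v \<times> nat) pre_digraph" where
  "multi_digraph V m =
     \<lparr> verts = V, arcs = {(u, v, i). u \<in> V \<and> v \<in> V \<and> i < m u v},
       tail = (\<lambda>(u, v, i). u), head = (\<lambda>(u, v, i). v) \<rparr>"

definition eulerian :: "('v, 'b) pre_digraph \<Rightarrow> bool" where
  "eulerian D \<longleftrightarrow> (\<forall>v\<in>verts D. in_degree D v = out_degree D v)"

definition eulerian_orientation ::
  "'v set \<Rightarrow> ('v \<Rightarrow> 'v \<Rightarrow> nat) \<Rightarrow> ('v \<Rightarrow> 'v \<Rightarrow> nat) \<Rightarrow> bool" where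
  "eulerian_orientation V e m \<longleftrightarrow> orientation e m \<and> eulerian (multi_digraph V m)"

text \<open>
  The predicate \<^const>\<open>tree\<close> only excludes directed cycles. The trees meant here are trees of
  the underlying undirected multigraph, hence the following notion of cycle, in which arcs may be
  traversed in either direction. Since the arcs are distinct, a single arc does not form a cycle
  of length 2, but two parallel or antiparallel arcs do.
\<close>

definition undirected_cycle :: "('v, 'b) pre_digraph \<Rightarrow> 'v list \<Rightarrow> 'b list \<Rightarrow> bool" where
  "undirected_cycle D vs es \<longleftrightarrow>
     es \<noteq> [] \<and> length vs = length es \<and> distinct vs \<and> distinct es \<and> set es \<subseteq> arcs D \<and>
     (\<forall>i<length es. {tail D (es ! i), head D (es ! i)} = {vs ! i, vs ! (Suc i mod length vs)})"

definition undirected_tree :: "('v, 'b) pre_digraph \<Rightarrow> bool" where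
  "undirected_tree D \<longleftrightarrow> connected D \<and> (\<nexists>vs es. undirected_cycle D vs es)"

definition arborescence :: "('v, 'b) pre_digraph \<Rightarrow> 'v \<Rightarrow> ('v, 'b) pre_digraph \<Rightarrow> bool" where
  "arborescence D r T \<longleftrightarrow>
     r \<in> verts D \<and> spanning T D \<and> undirected_tree T \<and>
     out_degree T r = 0 \<and> (\<forall>v\<in>verts D - {r}. out_degree T v = 1)"

definition arb_rooted :: "('v, 'b) pre_digraph \<Rightarrow> 'v \<Rightarrow> nat" where
  "arb_rooted D r = card {T. arborescence D r T}"

text \<open>
  For an Eulerian digraph the number of arborescences does not depend on the root, so an
  arbitrary vertex may be chosen. The choice depends on the vertex set only; in particular it is
  the same for all orientations of a multigraph.
\<close>

definition arb :: "('v, 'b) pre_digraph \<Rightarrow> nat" where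
  "arb D = arb_rooted D (SOME r. r \<in> verts D)"

end

theory Submission
  imports Defs "Jordan_Normal_Form.Determinant"
begin

text \<open>
  Fix a vertex \<open>r\<close>, let \<open>A = V - {r}\<close>, and let \<open>L m\<close> be the Laplacian of the orientation \<open>m\<close>
  (out-degrees on the diagonal, \<open>- m u v\<close> elsewhere) with the row and column of \<open>r\<close> deleted. By the
  directed matrix tree theorem, the number of arborescences rooted at \<open>r\<close> is \<open>det (L m)\<close>
  (lemmas \<open>arb_rooted_eq_sum\<close> and \<open>matrix_tree\<close>).

  In an Eulerian orientation the out-degree of a vertex is half of its degree, so the symmetric part
  of \<open>L m\<close> is half of the reduced Laplacian of the undirected graph. Hence all Eulerian orientations
  have the same quadratic form
  \<open>\<Sum>x u. e x u * (z x - z u)\<^sup>2 / 4\<close> with \<open>z r = 0\<close> (lemma \<open>qform_eulerian_orientation\<close>), and the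
  matrix of the symmetric orientation is the symmetric matrix of this form. The form is positive
  definite because the graph is connected. Writing \<open>P\<close> for this symmetric matrix, \<open>L m\<close> is \<open>P\<close> plus a
  skew-symmetric matrix, and the theorem becomes the fact that adding a skew-symmetric matrix to
  a positive definite \<open>P\<close> increases the determinant unless the added matrix is zero.

  This fact is proved in the more general form that \<open>det P \<le> det M\<close>, with equality only for
  \<open>M = P\<close>, whenever the quadratic form of \<open>M\<close> dominates that of \<open>P\<close> (lemma \<open>fdet_mono_qform\<close>).
  The generality makes an induction on the dimension possible: eliminating one variable by
  completing the square turns \<open>M\<close> and \<open>P\<close> into their Schur complements, and domination is
  inherited by these, whereas the property of having symmetric part \<open>P\<close> is not.
\<close>

section \<open>Determinants and domination of quadratic forms\<close>

definition qform :: "nat \<Rightarrow> (nat \<Rightarrow> nat \<Rightarrow> real) \<Rightarrow> (nat \<Rightarrow> real) \<Rightarrow> real" where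
  "qform n M x = (\<Sum>i<n. \<Sum>j<n. x i * M i j * x j)"

text \<open>
  Matrices are functions on the natural numbers, read on the indices below \<open>n\<close>. Then a leading
  submatrix is the same function with a smaller \<open>n\<close>, as an induction on the dimension wants it.
\<close>

definition fdet :: "nat \<Rightarrow> (nat \<Rightarrow> nat \<Rightarrow> real) \<Rightarrow> real" where
  "fdet n M = det (mat n n (\<lambda>(i, j). M i j))"

text \<open>
  The Schur complement of the corner entry \<open>M n n\<close> in the matrix \<open>M\<close> of size \<open>n + 1\<close>: what remains
  after Gaussian elimination of the index \<open>n\<close>.
\<close>

definition schur :: "nat \<Rightarrow> (nat \<Rightarrow> nat \<Rightarrow> real) \<Rightarrow> nat \<Rightarrow> nat \<Rightarrow> real" where
  "schur n M i j = M i j - M i n * M n j / M n n"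

lemma qform_cong:
  assumes "\<And>i j. i < n \<Longrightarrow> j < n \<Longrightarrow> M i j = N i j" "\<And>i. i < n \<Longrightarrow> x i = y i"
  shows "qform n M x = qform n N y"
  unfolding qform_def using assms by (intro sum.cong) auto

text \<open>
  Block Gaussian elimination: the matrix is the product of a unit upper triangular block matrix
  with a lower triangular one whose diagonal blocks are the Schur complement and \<open>M n n\<close>.
\<close>

lemma fdet_schur:
  assumes "M n n \<noteq> 0"
  shows "fdet (Suc n) M = M n n * fdet n (schur n M)"
proof -
  let ?S = "mat n n (\<lambda>(i, j). schur n M i j)"
  let ?B = "mat n 1 (\<lambda>(i, j). M i n)" and ?C = "mat 1 n (\<lambda>(i, j). M n j)"
  let ?b = "mat n 1 (\<lambda>(i, j). M i n / M n n)"
  let ?a = "mat 1 1 (\<lambda>(i, j). M n n)"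
  let ?L = "four_block_mat (1\<^sub>m n) ?b (0\<^sub>m 1 n) (1\<^sub>m 1)"
  let ?R = "four_block_mat ?S (0\<^sub>m n 1) ?C ?a"
  have "?L * ?R = four_block_mat (1\<^sub>m n * ?S + ?b * ?C) (1\<^sub>m n * 0\<^sub>m n 1 + ?b * ?a)
      (0\<^sub>m 1 n * ?S + 1\<^sub>m 1 * ?C) (0\<^sub>m 1 n * 0\<^sub>m n 1 + 1\<^sub>m 1 * ?a)"
    by (rule mult_four_block_mat) auto
  also have "\<dots> = mat (Suc n) (Suc n) (\<lambda>(i, j). M i j)"
  proof (rule eq_matI, goal_cases)
    case (1 i j)
    then show ?case
      using assms by (auto simp: less_Suc_eq scalar_prod_def schur_def)
  qed auto
  finally have "mat (Suc n) (Suc n) (\<lambda>(i, j). M i j) = ?L * ?R" ..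
  moreover have "det (?L * ?R) = det ?L * det ?R"
    by (rule det_mult[where n = "n + 1"]) (auto intro!: four_block_carrier_mat)
  moreover have "det ?L = 1"
    by (subst det_four_block_mat_lower_left_zero[where n = n and m = 1]) auto
  moreover have "det ?R = det ?S * M n n"
    by (subst det_four_block_mat_upper_right_zero[where n = n and m = 1]) (auto simp: det_single)
  ultimately show ?thesis
    by (simp add: fdet_def)
qed

text \<open>
  For a symmetric matrix the two linear factors coincide and the last summand is a multiple of a
  square. In general they differ, but still either of them can be made to vanish by the choice of
  \<open>x n\<close>, on which the Schur complement does not depend.
\<close>

lemma qform_complete_square:
  assumes "M n n \<noteq> 0"
  shows "qform (Suc n) M x = qform n (schur n M) x
    + M n n * (x n + (\<Sum>j<n. M n j * x j) / M n n) * (x n + (\<Sum>i<n. x i * M i n) / M n n)"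
proof -
  have "qform n (schur n M) x
      = qform n M x - (\<Sum>i<n. \<Sum>j<n. (x i * M i n) * (M n j * x j)) / M n n"
    unfolding qform_def schur_def
    by (simp add: sum_subtractf sum_divide_distrib algebra_simps)
  also have "(\<Sum>i<n. \<Sum>j<n. (x i * M i n) * (M n j * x j))
      = (\<Sum>i<n. x i * M i n) * (\<Sum>j<n. M n j * x j)"
    by (simp add: sum_product)
  finally have 1: "qform n (schur n M) x
      = qform n M x - (\<Sum>i<n. x i * M i n) * (\<Sum>j<n. M n j * x j) / M n n" .
  have 2: "qform (Suc n) M x = qform n M x + (\<Sum>i<n. x i * M i n) * x n
      + x n * (\<Sum>j<n. M n j * x j) + x n * M n n * x n"
    unfolding qform_def by (simp add: sum.distrib sum_distrib_left sum_distrib_right algebra_simps)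
  show ?thesis
    unfolding 1 2 using assms by (simp add: field_simps)
qed

lemma sum_times_unit:
  fixes f :: "nat \<Rightarrow> real"
  assumes "k < n"
  shows "(\<Sum>j<n. f j * (if j = k then 1 else 0)) = f k"
    and "(\<Sum>j<n. (if j = k then 1 else 0) * f j) = f k"
proof -
  have "(\<Sum>j<n. f j * (if j = k then 1 else 0)) = (\<Sum>j<n. if j = k then f k else 0)"
    by (intro sum.cong) auto
  with assms show "(\<Sum>j<n. f j * (if j = k then 1 else 0)) = f k" by simp
  then show "(\<Sum>j<n. (if j = k then 1 else 0) * f j) = f k" by (simp only: mult.commute)
qed

lemma qform_unit:
  assumes "k < n"
  shows "qform n M (\<lambda>i. if i = k then 1 else 0) = M k k"
proof -
  have "qform n M (\<lambda>i. if i = k then 1 else 0)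
      = (\<Sum>i<n. (if i = k then 1 else 0) * (\<Sum>j<n. M i j * (if j = k then 1 else 0)))"
    by (simp add: qform_def sum_distrib_left mult.assoc)
  also have "\<dots> = M k k"
    using assms by (simp only: sum_times_unit)
  finally show ?thesis .
qed

text \<open>
  The difference of the two sides is an affine function of \<open>t\<close>. Being nonnegative, it is constant,
  and the constant is \<open>- (b - p)\<^sup>2\<close>.
\<close>

lemma square_le_product_imp_eq:
  fixes b c p :: real
  assumes "\<And>t. (t + p) * (t + p) \<le> (t + b) * (t + c)"
  shows "b = p" "c = p"
proof -
  define d where "d = b + c - 2 * p"
  have *: "0 \<le> t * d + (b * c - p * p)" for t
    using assms[of t] by (simp add: d_def algebra_simps)
  have "d = 0"
  proof (rule ccontr)
    assume "d \<noteq> 0"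
    then show False
      \<comment> \<open>at this \<open>t\<close> the affine function takes the value \<open>-1\<close>\<close>
      using *[of "- (b * c - p * p + 1) / d"] by simp
  qed
  with *[of 0] have le: "0 \<le> b * c - p * p" and c: "c = 2 * p - b"
    by (auto simp: d_def)
  have "b * c - p * p = - ((b - p)\<^sup>2)"
    unfolding c by (simp add: power2_eq_square algebra_simps)
  with le have "(b - p)\<^sup>2 = 0" by (metis le_minus_iff minus_zero order_antisym zero_le_power2)
  then show "b = p" by simp
  with c show "c = p" by simp
qed

text \<open>
  Induction on \<open>n\<close>. Choosing the last coordinate such that the product of linear factors for \<open>M\<close>
  vanishes gives the form of the Schur complement of \<open>M\<close>; the same vector gives for \<open>P\<close> the form of
  its Schur complement plus a square. So the Schur complements satisfy the same domination, while
  the corner entries satisfy \<open>P n n \<le> M n n\<close>, and the determinants are the products of both.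

  If the determinants agree, then both factors agree, and the induction hypothesis makes the Schur
  complements equal. What remains of the domination is an inequality between the completed squares,
  which forces the last rows and columns to agree by \<open>square_le_product_imp_eq\<close>.
\<close>

lemma fdet_mono_qform:
  assumes sym: "\<And>i j. P i j = P j i"
    and pos: "\<And>x. \<exists>i<n. x i \<noteq> 0 \<Longrightarrow> 0 < qform n P x"
    and le: "\<And>x. qform n P x \<le> qform n M x"
  shows "0 < fdet n P \<and> fdet n P \<le> fdet n M
    \<and> (fdet n M = fdet n P \<longrightarrow> (\<forall>i<n. \<forall>j<n. M i j = P i j))"
  using assms
proof (induction n arbitrary: P M)
  case 0
  then show ?case by (simp add: fdet_def)
next
  case (Suc n P M)
  define \<alpha> where "\<alpha> = P n n"
  define a where "a = M n n"
  let ?u = "\<lambda>k i. if i = (k::nat) then 1 else (0::real)"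
  have \<alpha>: "0 < \<alpha>"
    using Suc.prems(2)[of "?u n"] by (auto simp: qform_unit \<alpha>_def)
  have a\<alpha>: "\<alpha> \<le> a"
    using Suc.prems(3)[of "?u n"] by (auto simp: qform_unit \<alpha>_def a_def)
  with \<alpha> have a: "0 < a" by simp
  note sqP = qform_complete_square[of P n, folded \<alpha>_def]
  note sqM = qform_complete_square[of M n, folded a_def]
  define p where "p x = (\<Sum>j<n. P n j * x j) / \<alpha>" for x
  define b where "b x = (\<Sum>j<n. M n j * x j) / a" for x
  define c where "c x = (\<Sum>i<n. x i * M i n) / a" for x
  have p': "(\<Sum>i<n. x i * P i n) / \<alpha> = p x" for x
    unfolding p_def by (simp add: Suc.prems(1)[of n] mult.commute)
  have P_upd: "qform (Suc n) P (x(n := t)) = qform n (schur n P) x + \<alpha> * ((t + p x) * (t + p x))" for x t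
  proof -
    have "qform n (schur n P) (x(n := t)) = qform n (schur n P) x"
      by (rule qform_cong) auto
    moreover have "p (x(n := t)) = p x" by (simp add: p_def)
    ultimately show ?thesis using sqP[of "x(n := t)"] \<alpha> by (simp add: p_def[symmetric] p')
  qed
  have M_upd: "qform (Suc n) M (x(n := t)) = qform n (schur n M) x + a * ((t + b x) * (t + c x))" for x t
  proof -
    have "qform n (schur n M) (x(n := t)) = qform n (schur n M) x"
      by (rule qform_cong) auto
    moreover have "b (x(n := t)) = b x" "c (x(n := t)) = c x" by (simp_all add: b_def c_def)
    ultimately show ?thesis using sqM[of "x(n := t)"] a by (simp add: b_def[symmetric] c_def[symmetric])
  qed
  have IH: "0 < fdet n (schur n P) \<and> fdet n (schur n P) \<le> fdet n (schur n M)
    \<and> (fdet n (schur n M) = fdet n (schur n P) \<longrightarrow> (\<forall>i<n. \<forall>j<n. schur n M i j = schur n P i j))"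
  proof (rule Suc.IH)
    show "schur n P i j = schur n P j i" for i j
      unfolding schur_def using Suc.prems(1) by (simp add: mult.commute)
    show "0 < qform n (schur n P) x" if "\<exists>i<n. x i \<noteq> 0" for x
    proof -
      have "0 < qform (Suc n) P (x(n := - p x))"
        using that by (intro Suc.prems(2)) (auto simp: less_Suc_eq)
      then show ?thesis by (simp add: P_upd)
    qed
    show "qform n (schur n P) x \<le> qform n (schur n M) x" for x
    proof -
      \<comment> \<open>\<open>- b x\<close> is the last coordinate at which the product for \<open>M\<close> vanishes\<close>
      have "qform n (schur n P) x \<le> qform (Suc n) P (x(n := - b x))"
        using \<alpha> by (simp add: P_upd)
      also have "\<dots> \<le> qform (Suc n) M (x(n := - b x))" by (rule Suc.prems(3))
      also have "\<dots> = qform n (schur n M) x" by (simp add: M_upd)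
      finally show ?thesis .
    qed
  qed
  let ?dP = "fdet n (schur n P)" and ?dM = "fdet n (schur n M)"
  have detP: "fdet (Suc n) P = \<alpha> * ?dP" and detM: "fdet (Suc n) M = a * ?dM"
    using fdet_schur[of P n] fdet_schur[of M n] \<alpha> a by (simp_all add: \<alpha>_def a_def)
  have "M i j = P i j" if eq: "a * ?dM = \<alpha> * ?dP" and ij: "i < Suc n" "j < Suc n" for i j
  proof -
    have "\<alpha> * ?dP \<le> \<alpha> * ?dM" "\<alpha> * ?dM \<le> a * ?dM"
      using IH \<alpha> a\<alpha> by (auto intro: mult_right_mono)
    with eq have "\<alpha> * ?dM = \<alpha> * ?dP" "a * ?dM = \<alpha> * ?dM" by linarith+
    with IH \<alpha> have aeq: "a = \<alpha>" and deq: "?dM = ?dP" by auto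
    have seq: "schur n M i j = schur n P i j" if "i < n" "j < n" for i j
      using IH deq that by blast
    have bc: "b x = p x" "c x = p x" for x
    proof -
      have "(t + p x) * (t + p x) \<le> (t + b x) * (t + c x)" for t
      proof -
        have "qform n (schur n M) x = qform n (schur n P) x"
          using seq by (rule qform_cong) auto
        then have "\<alpha> * ((t + p x) * (t + p x)) \<le> \<alpha> * ((t + b x) * (t + c x))"
          using Suc.prems(3)[of "x(n := t)"] unfolding P_upd M_upd aeq by linarith
        then show ?thesis using \<alpha> by simp
      qed
      then show "b x = p x" "c x = p x" by (rule square_le_product_imp_eq)+
    qed
    have row: "M n k = P n k" "M k n = P n k" if "k < n" for k
      using bc[of "?u k"] that \<alpha> by (simp_all add: b_def c_def p_def aeq sum_times_unit)
    have corner: "M n n = P n n" using aeq by (simp add: a_def \<alpha>_def)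
    show ?thesis
    proof (cases "i < n \<and> j < n")
      case True
      then show ?thesis
        using seq[of i j] row corner Suc.prems(1)[of i n] by (simp add: schur_def)
    next
      case False
      then show ?thesis
        using ij row corner Suc.prems(1) by (auto simp: less_Suc_eq)
    qed
  qed
  moreover have "\<alpha> * ?dP \<le> a * ?dM"
    using IH \<alpha> a\<alpha> by (intro mult_mono) auto
  ultimately show ?case
    using IH \<alpha> unfolding detP detM by auto
qed

section \<open>The directed matrix tree theorem\<close>

text \<open>
  This says that iterating \<open>f\<close> from any point of \<open>A\<close> eventually leaves \<open>A\<close>; the
  witness \<open>d\<close> may be taken to be the number of steps needed. With \<open>A\<close> the set of vertices other than
  the root, these are the parent functions of the trees directed towards the root.
\<close>

definition grounded :: "'a set \<Rightarrow> ('a \<Rightarrow> 'a) \<Rightarrow> bool" where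
  "grounded A f \<longleftrightarrow> (\<exists>d :: 'a \<Rightarrow> nat. \<forall>x\<in>A. d (f x) < d x)"

text \<open>
  Unless \<open>A\<close> itself is closed under \<open>f\<close>, some \<open>x\<close> is sent outside. A rank function for
  \<open>A - {x}\<close> would extend to \<open>A\<close> by giving rank 0 to the points outside, rank 1 to \<open>x\<close>, and by shifting
  all other ranks by 2; so \<open>A - {x}\<close> is a smaller set without a rank function.
\<close>

lemma not_grounded_closed_set:
  assumes "finite A" "\<not> grounded A f"
  obtains C where "C \<subseteq> A" "C \<noteq> {}" "f ` C \<subseteq> C"
proof -
  have "\<exists>C\<subseteq>A. C \<noteq> {} \<and> f ` C \<subseteq> C"
    using assms
  proof (induction A rule: finite_psubset_induct)
    case (psubset A)
    show ?case
    proof (cases "f ` A \<subseteq> A")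
      case True
      moreover have "A \<noteq> {}" using psubset.prems by (auto simp: grounded_def)
      ultimately show ?thesis by blast
    next
      case False
      then obtain x where x: "x \<in> A" "f x \<notin> A" by auto
      have "\<not> grounded (A - {x}) f"
      proof
        assume "grounded (A - {x}) f"
        then obtain d :: "'a \<Rightarrow> nat" where d: "\<forall>y\<in>A - {x}. d (f y) < d y"
          by (auto simp: grounded_def)
        let ?d = "\<lambda>y. if y = x then 1 else if y \<in> A then d y + 2 else 0"
        have "\<forall>y\<in>A. ?d (f y) < ?d y" using x d by auto
        then have "grounded A f" unfolding grounded_def by (intro exI[of _ ?d])
        with psubset.prems show False by simp
      qed
      with psubset.IH[of "A - {x}"] x show ?thesis by blast
    qed
  qed
  with that show ?thesis by blast
qed

text \<open>
  The matrix is the identity minus the adjacency matrix of \<open>f\<close> on \<open>A\<close>. Ordered by rank it is triangular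
  with unit diagonal. Instead of reordering, one sees in the Leibniz formula that only the identity
  contributes: a permutation \<open>p\<close> with a nonzero product moves each non-fixed point
  along \<open>f\<close>, hence lowers its rank, and this is impossible at a non-fixed point of least rank.
\<close>

lemma fdet_functional_grounded:
  assumes bij: "bij_betw v {..<n} A" and "grounded A f"
  shows "fdet n (\<lambda>i j. of_bool (i = j) - of_bool (f (v i) = v j)) = 1"
proof -
  let ?M = "\<lambda>i j. of_bool (i = j) - of_bool (f (v i) = v j) :: real"
  obtain d :: "'a \<Rightarrow> nat" where d: "\<And>x. x \<in> A \<Longrightarrow> d (f x) < d x"
    using assms(2) by (auto simp: grounded_def)
  have vA: "v i \<in> A" if "i < n" for i
    using bij that by (auto simp: bij_betw_def)
  have "fdet n ?M = (\<Sum>p | p permutes {0..<n}. signof p * (\<Prod>i = 0..<n. ?M i (p i)))"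
    unfolding fdet_def by (subst det_def') (auto intro!: sum.cong prod.cong dest: permutes_in_image)
  also have "\<dots> = (\<Sum>p | p permutes {0..<n}. if p = id then 1 else 0)"
  proof (intro sum.cong refl, clarify)
    fix p assume p: "p permutes {0..<n}"
    show "signof p * (\<Prod>i = 0..<n. ?M i (p i)) = (if p = id then 1 else 0)"
    proof (cases "p = id")
      case True
      have "?M i i = 1" if "i < n" for i
        using d[OF vA[OF that]] by auto
      with True show ?thesis by simp
    next
      case False
      then obtain k where "p k \<noteq> k" by (auto simp: fun_eq_iff)
      then obtain i where i: "p i \<noteq> i" "\<And>j. p j \<noteq> j \<Longrightarrow> d (v i) \<le> d (v j)"
        using ex_has_least_nat[of "\<lambda>i. p i \<noteq> i" k "\<lambda>i. d (v i)"] by blast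
      have "i < n" using i(1) p by (auto simp: permutes_def)
      have "p (p i) \<noteq> p i" using i(1) permutes_inj[OF p] by (auto dest: injD)
      with i(2) have "d (v i) \<le> d (v (p i))" by blast
      with d[OF vA[OF \<open>i < n\<close>]] have "f (v i) \<noteq> v (p i)" by auto
      with i(1) have zero: "?M i (p i) = 0" by simp
      have "(\<Prod>i = 0..<n. ?M i (p i)) = 0"
      proof (rule prod_zero)
        show "\<exists>i\<in>{0..<n}. ?M i (p i) = 0"
          using zero \<open>i < n\<close> by (intro bexI[of _ i]) simp_all
      qed simp
      with False show ?thesis by simp
    qed
  qed
  also have "\<dots> = 1"
    by (simp add: sum.delta finite_permutations permutes_id)
  finally show ?thesis .
qed

text \<open>
  The indicator vector of the set of points that never leave \<open>A\<close> is in the kernel. This set is obtained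
  as the largest subset of \<open>A\<close> closed under \<open>f\<close>; maximality is needed since a point of \<open>A\<close> outside the
  set must not be mapped into it.
\<close>

lemma fdet_functional_not_grounded:
  assumes bij: "bij_betw v {..<n} A" and ng: "\<not> grounded A f"
  shows "fdet n (\<lambda>i j. of_bool (i = j) - of_bool (f (v i) = v j)) = 0"
proof -
  let ?M = "\<lambda>i j. of_bool (i = j) - of_bool (f (v i) = v j) :: real"
  have "finite A" using bij bij_betw_finite by blast
  define C where "C = \<Union>{C. C \<subseteq> A \<and> f ` C \<subseteq> C}"
  have CA: "C \<subseteq> A" and "f ` C \<subseteq> C" by (auto simp: C_def)
  obtain C' where "C' \<subseteq> A" "C' \<noteq> {}" "f ` C' \<subseteq> C'"
    using not_grounded_closed_set[OF \<open>finite A\<close> ng] .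
  then obtain c where "c \<in> C"
    unfolding C_def by blast
  have C_iff: "f x \<in> C \<longleftrightarrow> x \<in> C" if "x \<in> A" for x
  proof
    assume "f x \<in> C"
    with that CA \<open>f ` C \<subseteq> C\<close> have "insert x C \<subseteq> A \<and> f ` insert x C \<subseteq> insert x C" by auto
    then show "x \<in> C" unfolding C_def by blast
  qed (use \<open>f ` C \<subseteq> C\<close> in auto)
  define x where "x = vec n (\<lambda>i. of_bool (v i \<in> C) :: real)"
  obtain k where "k < n" "v k = c"
    using \<open>c \<in> C\<close> CA bij by (auto simp: bij_betw_def)
  with \<open>c \<in> C\<close> have "x \<noteq> 0\<^sub>v n"
    by (auto simp: x_def dest!: arg_cong[where f = "\<lambda>x. x $ k"])
  moreover have "mat n n (\<lambda>(i, j). ?M i j) *\<^sub>v x = 0\<^sub>v n"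
  proof (rule eq_vecI)
    fix i assume "i < dim_vec (0\<^sub>v n)"
    then have i: "i < n" by simp
    have "(\<Sum>j<n. of_bool (f (v i) = v j) * of_bool (v j \<in> C)) = (\<Sum>y\<in>A. of_bool (f (v i) = y) * of_bool (y \<in> C) :: real)"
      using sum.reindex_bij_betw[OF bij, of "\<lambda>y. of_bool (f (v i) = y) * of_bool (y \<in> C) :: real"] .
    also have "\<dots> = (\<Sum>y\<in>A. if f (v i) = y then of_bool (f (v i) \<in> C) else 0)"
      by (intro sum.cong) auto
    also have "\<dots> = of_bool (f (v i) \<in> C)"
      using \<open>finite A\<close> CA by (auto simp: sum.delta')
    also have "\<dots> = of_bool (v i \<in> C)"
      using C_iff[of "v i"] bij i by (auto simp: bij_betw_def)
    finally have 1: "(\<Sum>j<n. of_bool (f (v i) = v j) * of_bool (v j \<in> C)) = (of_bool (v i \<in> C) :: real)" .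
    have "(\<Sum>j<n. of_bool (i = j) * of_bool (v j \<in> C)) = (\<Sum>j<n. if i = j then of_bool (v i \<in> C) else 0 :: real)"
      by (intro sum.cong) auto
    also have "\<dots> = of_bool (v i \<in> C)"
      using i by (simp add: sum.delta')
    finally have 2: "(\<Sum>j<n. of_bool (i = j) * of_bool (v j \<in> C)) = (of_bool (v i \<in> C) :: real)" .
    have "(mat n n (\<lambda>(i, j). ?M i j) *\<^sub>v x) $ i = (\<Sum>j<n. ?M i j * of_bool (v j \<in> C))"
      using i by (simp add: x_def scalar_prod_def lessThan_atLeast0)
    also have "\<dots> = 0"
      unfolding left_diff_distrib sum_subtractf 1 2 by simp
    finally show "(mat n n (\<lambda>(i, j). ?M i j) *\<^sub>v x) $ i = 0\<^sub>v n $ i" using i by simp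
  qed simp
  ultimately show ?thesis
    unfolding fdet_def by (subst det_0_iff_vec_prod_zero[of _ n]) (auto simp: x_def intro!: exI[of _ x])
qed

text \<open>
  The rows and columns are indexed through the enumeration \<open>v\<close> of the vertices other than the root.
\<close>

definition reduced_laplacian :: "'a set \<Rightarrow> ('a \<Rightarrow> 'a \<Rightarrow> real) \<Rightarrow> (nat \<Rightarrow> 'a) \<Rightarrow> nat \<Rightarrow> nat \<Rightarrow> real" where
  "reduced_laplacian V w v i j = (if i = j then \<Sum>u\<in>V. w (v i) u else 0) - w (v i) (v j)"

text \<open>
  The directed matrix tree theorem, with \<open>A\<close> as the set of non-root vertices. Row \<open>x\<close> of the
  reduced Laplacian is the sum over \<open>u\<close> of \<open>w x u\<close> times the difference of the unit vectors of \<open>x\<close>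
  and \<open>u\<close>, where the unit vector of a vertex outside \<open>A\<close> is zero. Multilinearity expands the
  determinant into a sum over all functions \<open>f\<close> that choose a \<open>u\<close> for each row, and the
  determinant that belongs to \<open>f\<close> is 1 or 0 according to whether \<open>f\<close> is grounded.
\<close>

lemma matrix_tree:
  assumes bij: "bij_betw v {..<n} A" and "A \<subseteq> V" "finite V"
  shows "fdet n (reduced_laplacian V w v)
    = (\<Sum>f | f \<in> A \<rightarrow>\<^sub>E V \<and> grounded A f. \<Prod>x\<in>A. w x (f x))"
proof -
  let ?E = "\<lambda>x u y. of_bool (x = y) - of_bool (u = y) :: real"
  let ?P = "{p. p permutes {0..<n}}"
  define h where "h = inv_into {..<n} v"
  have hv: "h (v i) = i" if "i < n" for i
    using bij that by (simp add: h_def bij_betw_def)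
  have inj: "v i = v j \<longleftrightarrow> i = j" if "i < n" "j < n" for i j
    using bij that by (auto simp: bij_betw_def dest: inj_onD)
  have vV: "v i \<in> V" if "i < n" for i
    using bij that assms(2) by (auto simp: bij_betw_def)
  have "finite A" using assms finite_subset by blast
  have row: "reduced_laplacian V w v i j = (\<Sum>u\<in>V. w (v i) u * ?E (v i) u (v j))"
    if "i < n" "j < n" for i j
  proof -
    have "(\<Sum>u\<in>V. w (v i) u * of_bool (u = v j)) = (\<Sum>u\<in>V. if u = v j then w (v i) (v j) else 0)"
      by (intro sum.cong) auto
    also have "\<dots> = w (v i) (v j)" using vV that \<open>finite V\<close> by simp
    finally have 1: "(\<Sum>u\<in>V. w (v i) u * of_bool (u = v j)) = w (v i) (v j)" .
    show ?thesis
      unfolding right_diff_distrib sum_subtractf 1 using inj[OF that] by (simp add: reduced_laplacian_def)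
  qed
  have expand: "(\<Prod>i = 0..<n. reduced_laplacian V w v i (p i))
      = (\<Sum>f\<in>A \<rightarrow>\<^sub>E V. (\<Prod>x\<in>A. w x (f x)) * (\<Prod>i = 0..<n. ?E (v i) (f (v i)) (v (p i))))"
    if p: "p permutes {0..<n}" for p
  proof -
    have pn: "p i < n" if "i < n" for i
      using permutes_in_image[OF p, of i] that by simp
    have re: "(\<Prod>i = 0..<n. g (v i) (p i)) = (\<Prod>x\<in>A. g x (p (h x)))" for g :: "'a \<Rightarrow> nat \<Rightarrow> real"
    proof -
      have "(\<Prod>x\<in>A. g x (p (h x))) = (\<Prod>i<n. g (v i) (p (h (v i))))"
        using prod.reindex_bij_betw[OF bij, of "\<lambda>x. g x (p (h x))"] by simp
      also have "\<dots> = (\<Prod>i = 0..<n. g (v i) (p i))"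
        by (simp add: hv lessThan_atLeast0)
      finally show ?thesis by simp
    qed
    have "(\<Prod>i = 0..<n. reduced_laplacian V w v i (p i))
        = (\<Prod>i = 0..<n. \<Sum>u\<in>V. w (v i) u * ?E (v i) u (v (p i)))"
      using pn by (intro prod.cong) (auto simp: row)
    also have "\<dots> = (\<Prod>x\<in>A. \<Sum>u\<in>V. w x u * ?E x u (v (p (h x))))"
      by (rule re)
    also have "\<dots> = (\<Sum>f\<in>A \<rightarrow>\<^sub>E V. \<Prod>x\<in>A. w x (f x) * ?E x (f x) (v (p (h x))))"
      using \<open>finite A\<close> \<open>finite V\<close> by (intro prod_sum_PiE) auto
    also have "\<dots> = (\<Sum>f\<in>A \<rightarrow>\<^sub>E V. (\<Prod>x\<in>A. w x (f x)) * (\<Prod>x\<in>A. ?E x (f x) (v (p (h x)))))"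
      by (simp only: prod.distrib)
    also have "\<dots> = (\<Sum>f\<in>A \<rightarrow>\<^sub>E V. (\<Prod>x\<in>A. w x (f x)) * (\<Prod>i = 0..<n. ?E (v i) (f (v i)) (v (p i))))"
      by (intro sum.cong refl arg_cong2[where f = "(*)"] re[symmetric])
    finally show ?thesis .
  qed
  have leibniz: "fdet n M = (\<Sum>p\<in>?P. signof p * (\<Prod>i = 0..<n. M i (p i)))" for M
    unfolding fdet_def by (subst det_def') (auto intro!: sum.cong prod.cong dest: permutes_in_image)
  have inner: "(\<Sum>p\<in>?P. signof p * (\<Prod>i = 0..<n. ?E (v i) (f (v i)) (v (p i)))) = of_bool (grounded A f)" for f
  proof -
    have "(\<Sum>p\<in>?P. signof p * (\<Prod>i = 0..<n. ?E (v i) (f (v i)) (v (p i))))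
        = fdet n (\<lambda>i j. of_bool (i = j) - of_bool (f (v i) = v j))"
      unfolding leibniz
    proof (intro sum.cong refl arg_cong2[where f = "(*)"] prod.cong)
      fix p i assume "p \<in> ?P" "i \<in> {0..<n}"
      then have "i < n" "p i < n" using permutes_in_image[of p "{0..<n}" i] by auto
      then show "?E (v i) (f (v i)) (v (p i)) = of_bool (i = p i) - of_bool (f (v i) = v (p i))"
        by (simp add: inj)
    qed
    then show ?thesis
      using fdet_functional_grounded[OF bij, of f] fdet_functional_not_grounded[OF bij, of f] by auto
  qed
  have "fdet n (reduced_laplacian V w v)
      = (\<Sum>p\<in>?P. signof p * (\<Sum>f\<in>A \<rightarrow>\<^sub>E V. (\<Prod>x\<in>A. w x (f x)) * (\<Prod>i = 0..<n. ?E (v i) (f (v i)) (v (p i)))))"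
    unfolding leibniz by (intro sum.cong refl) (simp only: expand mem_Collect_eq)
  also have "\<dots> = (\<Sum>f\<in>A \<rightarrow>\<^sub>E V. (\<Prod>x\<in>A. w x (f x)) * (\<Sum>p\<in>?P. signof p * (\<Prod>i = 0..<n. ?E (v i) (f (v i)) (v (p i)))))"
    by (subst (2) sum_distrib_left, subst sum_distrib_left, subst sum.swap) (simp only: mult.left_commute)
  also have "\<dots> = (\<Sum>f\<in>A \<rightarrow>\<^sub>E V. if grounded A f then \<Prod>x\<in>A. w x (f x) else 0)"
    unfolding inner by (intro sum.cong) auto
  also have "\<dots> = (\<Sum>f | f \<in> A \<rightarrow>\<^sub>E V \<and> grounded A f. \<Prod>x\<in>A. w x (f x))"
    using \<open>finite A\<close> \<open>finite V\<close> by (subst sum.inter_filter[symmetric]) (auto simp: finite_PiE)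
  finally show ?thesis .
qed

section \<open>Arborescences as grounded functions\<close>

text \<open>
  The subgraph in which each \<open>x \<in> A\<close> has exactly one outgoing arc, namely the one numbered \<open>k x\<close> among
  the parallel arcs from \<open>x\<close> to \<open>f x\<close>. The arborescences will be those with grounded \<open>f\<close>.
\<close>

definition functional_subgraph ::
  "'v set \<Rightarrow> 'v set \<Rightarrow> ('v \<Rightarrow> 'v) \<Rightarrow> ('v \<Rightarrow> nat) \<Rightarrow> ('v, 'v \<times> 'v \<times> nat) pre_digraph" where
  "functional_subgraph V A f k =
     \<lparr> verts = V, arcs = (\<lambda>x. (x, f x, k x)) ` A,
       tail = (\<lambda>(u, v, i). u), head = (\<lambda>(u, v, i). v) \<rparr>"

lemma connected_functional_subgraph:
  assumes f: "f \<in> A \<rightarrow> V" and "grounded A f" and V: "V = insert r A" "r \<notin> A"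
  shows "connected (functional_subgraph V A f k)"
proof -
  let ?T = "functional_subgraph V A f k"
  let ?S = "arcs_ends (with_proj (mk_symmetric ?T))"
  obtain d :: "'a \<Rightarrow> nat" where d: "\<And>x. x \<in> A \<Longrightarrow> d (f x) < d x"
    using assms(2) by (auto simp: grounded_def)
  have verts: "verts (with_proj (mk_symmetric ?T)) = V"
    by (simp add: mk_symmetric_def functional_subgraph_def)
  have step: "(x, f x) \<in> ?S" "(f x, x) \<in> ?S" if "x \<in> A" for x
    using that by (auto simp: arcs_ends_conv mk_symmetric_def functional_subgraph_def)
  have conn: "(x, r) \<in> rtrancl_on V ?S \<and> (r, x) \<in> rtrancl_on V ?S" if "x \<in> V" for x
    using that
  proof (induction "d x" arbitrary: x rule: less_induct)
    case less
    show ?case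
    proof (cases "x = r")
      case True
      with less.prems show ?thesis by (auto intro: rtrancl_on_refl)
    next
      case False
      with less.prems V have "x \<in> A" by auto
      with f have "f x \<in> V" by auto
      with less.hyps[of "f x"] d[OF \<open>x \<in> A\<close>]
      have "(f x, r) \<in> rtrancl_on V ?S" "(r, f x) \<in> rtrancl_on V ?S" by auto
      with step[OF \<open>x \<in> A\<close>] less.prems \<open>f x \<in> V\<close> show ?thesis
        by (meson rtrancl_on_into_rtrancl_on converse_rtrancl_on_into_rtrancl_on)
    qed
  qed
  show ?thesis
    unfolding connected_def strongly_connected_def reachable_def verts
    using conn V by (blast intro: rtrancl_on_trans)
qed

text \<open>
  At a vertex of greatest rank on an undirected cycle, an incident arc cannot enter, because its tail
  would have greater rank. So the two cycle arcs at this vertex both leave it and are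
  the same arc; the cycle then is a loop, which \<open>d (f x) < d x\<close> excludes.
\<close>

lemma no_cycle_functional_subgraph:
  assumes "grounded A f"
  shows "\<not> undirected_cycle (functional_subgraph V A f k) vs es"
proof
  let ?T = "functional_subgraph V A f k"
  assume "undirected_cycle ?T vs es"
  then have cyc: "es \<noteq> []" "length vs = length es" "distinct es" "set es \<subseteq> arcs ?T"
    "\<And>i. i < length es \<Longrightarrow> {tail ?T (es ! i), head ?T (es ! i)} = {vs ! i, vs ! (Suc i mod length vs)}"
    by (auto simp: undirected_cycle_def)
  obtain d :: "'a \<Rightarrow> nat" where d: "\<And>x. x \<in> A \<Longrightarrow> d (f x) < d x"
    using assms by (auto simp: grounded_def)
  let ?n = "length es"
  have n: "0 < ?n" using cyc(1) by simp
  obtain m where m: "m < ?n" "\<And>i. i < ?n \<Longrightarrow> d (vs ! i) \<le> d (vs ! m)"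
  proof -
    let ?D = "(\<lambda>i. d (vs ! i)) ` {..<?n}"
    have "Max ?D \<in> ?D" using n by (intro Max_in) auto
    then obtain m where "m < ?n" "Max ?D = d (vs ! m)" by auto
    moreover have "d (vs ! i) \<le> Max ?D" if "i < ?n" for i
      using that by (intro Max_ge) auto
    ultimately show thesis using that[of m] by simp
  qed
  have arc: "es ! i = (vs ! m, f (vs ! m), k (vs ! m))"
    if i: "i < ?n" and m_end: "m = i \<or> m = Suc i mod ?n" for i
  proof -
    obtain x where x: "x \<in> A" "es ! i = (x, f x, k x)"
      using cyc(4) nth_mem[OF i] by (auto simp: functional_subgraph_def)
    have ends: "{x, f x} = {vs ! i, vs ! (Suc i mod ?n)}"
      using cyc(5)[OF i] x cyc(2) by (simp add: functional_subgraph_def)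
    have "Suc i mod ?n < ?n" using n by simp
    with m(2) i have "\<forall>y\<in>{vs ! i, vs ! (Suc i mod ?n)}. d y \<le> d (vs ! m)"
      by simp
    then have "d x \<le> d (vs ! m)"
      unfolding ends[symmetric] by simp
    moreover have "vs ! m = x \<or> vs ! m = f x" using ends m_end by (auto simp: doubleton_eq_iff)
    ultimately have "vs ! m = x" using d[OF x(1)] by auto
    with x show ?thesis by simp
  qed
  \<comment> \<open>the cyclic predecessor of \<open>m\<close>\<close>
  define i where "i = (if m = 0 then ?n - 1 else m - 1)"
  have i: "i < ?n" "Suc i mod ?n = m"
    using m(1) by (auto simp: i_def)
  then have "es ! i = es ! m" using arc m(1) by auto
  then have "i = m" using cyc(3) i(1) m(1) by (simp add: nth_eq_iff_index_eq)
  with i have "vs ! m = vs ! (Suc m mod ?n)" by simp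
  moreover obtain x where x: "x \<in> A" "es ! m = (x, f x, k x)"
    using cyc(4) nth_mem[OF m(1)] by (auto simp: functional_subgraph_def)
  ultimately have "x = f x"
    using cyc(5)[OF m(1)] cyc(2) by (auto simp: functional_subgraph_def)
  with d[OF x(1)] show False by simp
qed

text \<open>
  Some point \<open>x\<close> of the finite set \<open>C\<close> is periodic under \<open>f\<close>, and its orbit is a directed cycle. Taking
  the least period makes the vertices distinct. Periods 1 and 2 give cycles as well: a loop and a
  pair of antiparallel arcs.
\<close>

lemma functional_subgraph_cycle:
  assumes "finite C" "C \<noteq> {}" "C \<subseteq> A" "f ` C \<subseteq> C"
  shows "\<exists>vs es. undirected_cycle (functional_subgraph V A f k) vs es"
proof -
  let ?T = "functional_subgraph V A f k"
  obtain c where "c \<in> C" using assms(2) by blast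
  have inC: "(f ^^ i) x \<in> C" if "x \<in> C" for i x
    using that assms(4) by (induction i) auto
  have "\<not> inj (\<lambda>i. (f ^^ i) c)"
  proof
    assume "inj (\<lambda>i. (f ^^ i) c)"
    moreover have "range (\<lambda>i. (f ^^ i) c) \<subseteq> C" using inC \<open>c \<in> C\<close> by auto
    ultimately show False
      using assms(1) finite_imageD finite_subset infinite_UNIV_nat by blast
  qed
  then obtain i j where ij: "i < j" "(f ^^ i) c = (f ^^ j) c"
    unfolding inj_def by (metis nat_neq_iff)
  define x where "x = (f ^^ i) c"
  have x: "x \<in> C" using inC \<open>c \<in> C\<close> by (simp add: x_def)
  have "(f ^^ (j - i)) x = (f ^^ (j - i + i)) c"
    by (simp only: x_def funpow_add comp_apply)
  also have "\<dots> = x" using ij by (simp add: x_def)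
  finally have "(f ^^ (j - i)) x = x" .
  with ij(1) have ex: "\<exists>m. 0 < m \<and> (f ^^ m) x = x" by (intro exI[of _ "j - i"]) auto
  define m where "m = (LEAST m. 0 < m \<and> (f ^^ m) x = x)"
  have m: "0 < m" "(f ^^ m) x = x"
    using LeastI_ex[OF ex] by (auto simp: m_def)
  have minimal: "(f ^^ l) x \<noteq> x" if "0 < l" "l < m" for l
    using not_less_Least[of l "\<lambda>m. 0 < m \<and> (f ^^ m) x = x"] that by (auto simp: m_def)
  have neq: "(f ^^ a) x \<noteq> (f ^^ b) x" if "a < b" "b < m" for a b
  proof
    assume "(f ^^ a) x = (f ^^ b) x"
    then have "(f ^^ (m - b + a)) x = (f ^^ (m - b + b)) x"
      by (simp only: funpow_add comp_apply)
    also have "\<dots> = x" using that m by simp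
    finally have "(f ^^ (m - b + a)) x = x" .
    moreover have "0 < m - b + a" "m - b + a < m" using that by arith+
    ultimately show False by (simp only: minimal)
  qed
  have inj: "a = b" if "a < m" "b < m" "(f ^^ a) x = (f ^^ b) x" for a b
    using neq[of a b] neq[of b a] that by (cases a b rule: linorder_cases) simp_all
  define vs where "vs = map (\<lambda>i. (f ^^ i) x) [0..<m]"
  define es where "es = map (\<lambda>y. (y, f y, k y)) vs"
  have dvs: "distinct vs"
    unfolding vs_def distinct_map by (intro conjI inj_onI inj) simp_all
  have "undirected_cycle ?T vs es"
    unfolding undirected_cycle_def
  proof (intro conjI allI impI)
    show "es \<noteq> []" using m by (simp add: es_def vs_def)
    show "length vs = length es" by (simp add: es_def)
    show "distinct vs" by (rule dvs)
    show "distinct es" using dvs by (simp add: es_def distinct_map inj_on_def)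
    show "set es \<subseteq> arcs ?T"
      using inC[OF x] assms(3) by (auto simp: es_def vs_def functional_subgraph_def)
    fix i assume "i < length es"
    then have i: "i < m" by (simp add: es_def vs_def)
    have "vs ! (Suc i mod length vs) = f ((f ^^ i) x)"
    proof (cases "Suc i = m")
      case True
      then show ?thesis using m by (auto simp: vs_def)
    next
      case False
      then show ?thesis using i by (simp add: vs_def)
    qed
    then show "{tail ?T (es ! i), head ?T (es ! i)} = {vs ! i, vs ! (Suc i mod length vs)}"
      using i by (simp add: es_def vs_def functional_subgraph_def)
  qed
  then show ?thesis by blast
qed

lemma out_arcs_functional_subgraph:
  "out_arcs (functional_subgraph V A f k) x = (if x \<in> A then {(x, f x, k x)} else {})"
  by (auto simp: out_arcs_def functional_subgraph_def)

lemma arborescence_functional_subgraph: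
  assumes f: "f \<in> A \<rightarrow> V" and k: "\<And>x. x \<in> A \<Longrightarrow> k x < m x (f x)"
    and gr: "grounded A f" and V: "V = insert r A" "r \<notin> A"
  shows "arborescence (multi_digraph V m) r (functional_subgraph V A f k)"
proof -
  let ?T = "functional_subgraph V A f k"
  have "wf_digraph (multi_digraph V m)" "wf_digraph ?T"
    using f V by (auto simp: wf_digraph_def multi_digraph_def functional_subgraph_def)
  then have "spanning ?T (multi_digraph V m)"
    using f k V by (auto simp: spanning_def subgraph_def compatible_def multi_digraph_def functional_subgraph_def)
  moreover have "undirected_tree ?T"
    unfolding undirected_tree_def
    using connected_functional_subgraph[OF f gr V] no_cycle_functional_subgraph[OF gr] by blast
  moreover have "out_degree ?T r = 0" "\<forall>v\<in>V - {r}. out_degree ?T v = 1"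
    using V by (auto simp: out_degree_def out_arcs_functional_subgraph)
  ultimately show ?thesis
    using V by (simp add: arborescence_def multi_digraph_def)
qed

lemma verts_multi_digraph: "verts (multi_digraph V m) = V"
  by (simp add: multi_digraph_def)

text \<open>
  The degree condition alone yields \<open>f\<close> and \<open>k\<close>. If \<open>f\<close> were not grounded, a closed set would
  produce an undirected cycle in the tree.
\<close>

lemma arborescence_is_functional_subgraph:
  assumes arb: "arborescence (multi_digraph V m) r T" and V: "V = insert r A" "r \<notin> A" "finite A"
  obtains f k where "f \<in> A \<rightarrow>\<^sub>E V" "k \<in> (\<Pi>\<^sub>E x\<in>A. {..<m x (f x)})" "grounded A f"
    "T = functional_subgraph V A f k"
proof -
  let ?D = "multi_digraph V m"
  have sp: "spanning T ?D" and tree: "undirected_tree T" and out_r: "out_degree T r = 0"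
    and out_V: "\<forall>v\<in>V - {r}. out_degree T v = 1"
    using arb unfolding arborescence_def by (simp_all add: verts_multi_digraph)
  have out: "out_degree T v = 1" if "v \<in> A" for v
    using out_V V that by blast
  have "verts ?D = verts T" "compatible ?D T" and arcsT: "arcs T \<subseteq> arcs ?D"
    using sp unfolding spanning_def subgraph_def by simp_all
  then have vertsT: "verts T = V"
    and tailT: "tail T = (\<lambda>(u, v, i). u)" and headT: "head T = (\<lambda>(u, v, i). v)"
    by (simp_all add: compatible_def multi_digraph_def)
  have "finite (arcs ?D)"
  proof -
    have "arcs ?D = (SIGMA u:V. SIGMA v:V. {..<m u v})"
      by (auto simp: multi_digraph_def)
    with V show ?thesis by simp
  qed
  then have "finite (arcs T)" using arcsT finite_subset by blast
  have "\<exists>u i. out_arcs T x = {(x, u, i)}" if xA: "x \<in> A" for x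
  proof -
    obtain a where "out_arcs T x = {a}"
      using out[OF xA] by (auto simp: out_degree_def card_1_singleton_iff)
    moreover from this have "tail T a = x" by (auto simp: out_arcs_def)
    ultimately show ?thesis by (cases a) (auto simp: tailT)
  qed
  then have "\<forall>x\<in>A. \<exists>u. \<exists>i. out_arcs T x = {(x, u, i)}" by blast
  from bchoice[OF this] obtain f0 where "\<forall>x\<in>A. \<exists>i. out_arcs T x = {(x, f0 x, i)}" ..
  from bchoice[OF this] obtain k0 where fk0: "\<forall>x\<in>A. out_arcs T x = {(x, f0 x, k0 x)}" ..
  define f where "f = restrict f0 A"
  define k where "k = restrict k0 A"
  have fk: "out_arcs T x = {(x, f x, k x)}" if "x \<in> A" for x
    using fk0 that by (simp add: f_def k_def)
  have "out_arcs T r = {}"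
    using out_r \<open>finite (arcs T)\<close> by (simp add: out_degree_def out_arcs_def)
  have "a \<in> (\<lambda>x. (x, f x, k x)) ` A" if "a \<in> arcs T" for a
  proof -
    have a: "a \<in> out_arcs T (tail T a)" using that by (simp add: out_arcs_def)
    moreover have "tail T a \<in> V"
      using that arcsT by (auto simp: multi_digraph_def tailT)
    ultimately have "tail T a \<in> A"
      using \<open>out_arcs T r = {}\<close> V(1) by (metis empty_iff insertE)
    with fk[OF this] a show ?thesis by blast
  qed
  moreover have inT: "(x, f x, k x) \<in> arcs T" if "x \<in> A" for x
    using fk[OF that] by (auto simp: out_arcs_def)
  ultimately have "arcs T = (\<lambda>x. (x, f x, k x)) ` A" by blast
  with vertsT tailT headT have T: "T = functional_subgraph V A f k"
    by (simp add: functional_subgraph_def)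
  have fkD: "f x \<in> V" "k x < m x (f x)" if "x \<in> A" for x
    using inT[OF that] arcsT by (auto simp: multi_digraph_def)
  show ?thesis
  proof (rule that)
    show "f \<in> A \<rightarrow>\<^sub>E V" using fkD by (simp add: f_def PiE_iff)
    show "k \<in> (\<Pi>\<^sub>E x\<in>A. {..<m x (f x)})" using fkD by (simp add: k_def PiE_iff)
    show "grounded A f"
    proof (rule ccontr)
      assume "\<not> grounded A f"
      then obtain C where C: "C \<subseteq> A" "C \<noteq> {}" "f ` C \<subseteq> C"
        using not_grounded_closed_set V(3) by blast
      then have "finite C" using V(3) finite_subset by blast
      then have "\<exists>vs es. undirected_cycle T vs es"
        unfolding T using C by (intro functional_subgraph_cycle)
      with tree show False
        unfolding undirected_tree_def by blast
    qed
  qed (rule T)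
qed

lemma inj_on_functional_subgraph:
  "inj_on (\<lambda>(f, k). functional_subgraph V A f k) (SIGMA f:(A \<rightarrow>\<^sub>E V). \<Pi>\<^sub>E x\<in>A. B f x)"
proof (rule inj_onI, clarify)
  fix f k f' k'
  assume mem: "f \<in> A \<rightarrow>\<^sub>E V" "f' \<in> A \<rightarrow>\<^sub>E V" "k \<in> (\<Pi>\<^sub>E x\<in>A. B f x)" "k' \<in> (\<Pi>\<^sub>E x\<in>A. B f' x)"
    and eq: "functional_subgraph V A f k = functional_subgraph V A f' k'"
  have "(\<lambda>x. (x, f x, k x)) ` A = (\<lambda>x. (x, f' x, k' x)) ` A"
    using eq by (simp add: functional_subgraph_def)
  then have "\<forall>x\<in>A. (x, f x, k x) \<in> (\<lambda>x. (x, f' x, k' x)) ` A" by blast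
  then have eqs: "f x = f' x" "k x = k' x" if "x \<in> A" for x
    using that by auto
  have "f \<in> extensional A" "f' \<in> extensional A" "k \<in> extensional A" "k' \<in> extensional A"
    using mem by (simp_all add: PiE_iff)
  then show "f = f' \<and> k = k'"
    by (auto intro: extensionalityI eqs)
qed

lemma arb_rooted_eq_sum:
  assumes V: "V = insert r A" "r \<notin> A" "finite A"
  shows "arb_rooted (multi_digraph V m) r = (\<Sum>f | f \<in> A \<rightarrow>\<^sub>E V \<and> grounded A f. \<Prod>x\<in>A. m x (f x))"
proof -
  let ?F = "{f \<in> A \<rightarrow>\<^sub>E V. grounded A f}"
  let ?S = "SIGMA f:?F. \<Pi>\<^sub>E x\<in>A. {..<m x (f x)}"
  have "finite ?F" using V by (auto intro!: finite_PiE)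
  have "{T. arborescence (multi_digraph V m) r T} = (\<lambda>(f, k). functional_subgraph V A f k) ` ?S"
  proof (intro equalityI subsetI, goal_cases)
    case (1 T)
    then have "arborescence (multi_digraph V m) r T" by simp
    then obtain f k where "f \<in> A \<rightarrow>\<^sub>E V" "k \<in> (\<Pi>\<^sub>E x\<in>A. {..<m x (f x)})" "grounded A f"
      "T = functional_subgraph V A f k"
      using arborescence_is_functional_subgraph V by metis
    then show ?case by auto
  next
    case (2 T)
    then show ?case
      using V by (auto intro!: arborescence_functional_subgraph dest: PiE_mem)
  qed
  moreover have "inj_on (\<lambda>(f, k). functional_subgraph V A f k) ?S"
    by (rule inj_on_subset[OF inj_on_functional_subgraph[where B = "\<lambda>f x. {..<m x (f x)}"]]) auto
  ultimately have "arb_rooted (multi_digraph V m) r = card ?S"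
    by (simp add: arb_rooted_def card_image)
  also have "\<dots> = (\<Sum>f\<in>?F. card (\<Pi>\<^sub>E x\<in>A. {..<m x (f x)}))"
    using \<open>finite ?F\<close> V by (intro card_SigmaI) (auto intro!: finite_PiE)
  also have "\<dots> = (\<Sum>f\<in>?F. \<Prod>x\<in>A. m x (f x))"
    using V by (simp add: card_PiE)
  finally show ?thesis .
qed

section \<open>Laplacians of Eulerian orientations\<close>

lemma in_degree_multi_digraph:
  assumes "finite V" "x \<in> V"
  shows "in_degree (multi_digraph V m) x = (\<Sum>u\<in>V. m u x)"
proof -
  have "in_arcs (multi_digraph V m) x = (\<lambda>(u, i). (u, x, i)) ` (SIGMA u:V. {..<m u x})"
    using assms(2) by (auto simp: in_arcs_def multi_digraph_def)
  moreover have "inj_on (\<lambda>(u, i). (u, x, i)) (SIGMA u:V. {..<m u x})"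
    by (auto intro: inj_onI)
  ultimately show ?thesis
    using assms(1) by (simp add: in_degree_def card_image)
qed

lemma out_degree_multi_digraph:
  assumes "finite V" "x \<in> V"
  shows "out_degree (multi_digraph V m) x = (\<Sum>u\<in>V. m x u)"
proof -
  have "out_arcs (multi_digraph V m) x = (\<lambda>(u, i). (x, u, i)) ` (SIGMA u:V. {..<m x u})"
    using assms(2) by (auto simp: out_arcs_def multi_digraph_def)
  moreover have "inj_on (\<lambda>(u, i). (x, u, i)) (SIGMA u:V. {..<m x u})"
    by (auto intro: inj_onI)
  ultimately show ?thesis
    using assms(1) by (simp add: out_degree_def card_image)
qed

lemma eulerian_multi_digraph_iff:
  assumes "finite V"
  shows "eulerian (multi_digraph V m) \<longleftrightarrow> (\<forall>x\<in>V. (\<Sum>u\<in>V. m u x) = (\<Sum>u\<in>V. m x u))"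
  using assms
  by (simp add: eulerian_def verts_multi_digraph in_degree_multi_digraph out_degree_multi_digraph)

text \<open>
  Setting \<open>z\<close> to zero at the root allows the sums to range over all vertices, so that the special
  role of the root disappears.
\<close>

lemma qform_reduced_laplacian:
  assumes bij: "bij_betw v {..<n} A" and V: "V = insert r A" "r \<notin> A" "finite A" and z: "z r = 0"
  shows "qform n (reduced_laplacian V w v) (\<lambda>i. z (v i))
    = (\<Sum>x\<in>V. \<Sum>u\<in>V. w x u * z x * (z x - z u))"
proof -
  have re: "(\<Sum>i<n. g (v i)) = (\<Sum>x\<in>V. g x)" if "g r = 0" for g :: "'a \<Rightarrow> real"
    using sum.reindex_bij_betw[OF bij, of g] V that by simp
  have "(\<Sum>j<n. z (v i) * reduced_laplacian V w v i j * z (v j))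
      = (\<Sum>u\<in>V. w (v i) u * z (v i) * (z (v i) - z u))" if i: "i < n" for i
  proof -
    let ?s = "\<Sum>u\<in>V. w (v i) u"
    have "(\<Sum>j<n. z (v i) * reduced_laplacian V w v i j * z (v j))
        = (\<Sum>j<n. if i = j then z (v i) * ?s * z (v i) else 0) - (\<Sum>j<n. z (v i) * w (v i) (v j) * z (v j))"
      unfolding sum_subtractf[symmetric]
      by (intro sum.cong) (auto simp: reduced_laplacian_def algebra_simps)
    also have "(\<Sum>j<n. if i = j then z (v i) * ?s * z (v i) else 0) = z (v i) * ?s * z (v i)"
      using i by simp
    also have "(\<Sum>j<n. z (v i) * w (v i) (v j) * z (v j)) = (\<Sum>u\<in>V. z (v i) * w (v i) u * z u)"
      using z by (intro re[of "\<lambda>u. z (v i) * w (v i) u * z u"]) simp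
    also have "z (v i) * ?s * z (v i) - (\<Sum>u\<in>V. z (v i) * w (v i) u * z u)
        = (\<Sum>u\<in>V. w (v i) u * z (v i) * (z (v i) - z u))"
      by (simp add: sum_subtractf sum_distrib_left sum_distrib_right algebra_simps)
    finally show ?thesis .
  qed
  then have "qform n (reduced_laplacian V w v) (\<lambda>i. z (v i))
      = (\<Sum>i<n. \<Sum>u\<in>V. w (v i) u * z (v i) * (z (v i) - z u))"
    by (simp add: qform_def)
  also have "\<dots> = (\<Sum>x\<in>V. \<Sum>u\<in>V. w x u * z x * (z x - z u))"
    using z by (intro re[of "\<lambda>x. \<Sum>u\<in>V. w x u * z x * (z x - z u)"]) simp
  finally show ?thesis .
qed

text \<open>
  Expand \<open>w x u * (z x - z u)\<^sup>2\<close>: by balance, the terms with \<open>(z u)\<^sup>2\<close> and those with \<open>(z x)\<^sup>2\<close> have the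
  same sum. The right-hand side depends on \<open>w x u + w u x\<close> only, which is the number of edges
  between \<open>x\<close> and \<open>u\<close> when \<open>w\<close> is an orientation.
\<close>

lemma balanced_laplacian_form:
  fixes w :: "'a \<Rightarrow> 'a \<Rightarrow> real"
  assumes "\<And>x. x \<in> V \<Longrightarrow> (\<Sum>u\<in>V. w u x) = (\<Sum>u\<in>V. w x u)"
  shows "(\<Sum>x\<in>V. \<Sum>u\<in>V. w x u * z x * (z x - z u))
    = (\<Sum>x\<in>V. \<Sum>u\<in>V. (w x u + w u x) * (z x - z u)\<^sup>2) / 4"
proof -
  have "(\<Sum>x\<in>V. \<Sum>u\<in>V. w x u * (z u)\<^sup>2) = (\<Sum>u\<in>V. (\<Sum>x\<in>V. w x u) * (z u)\<^sup>2)"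
    by (subst sum.swap) (simp add: sum_distrib_right)
  also have "\<dots> = (\<Sum>u\<in>V. (\<Sum>x\<in>V. w u x) * (z u)\<^sup>2)"
    by (intro sum.cong) (auto simp: assms)
  finally have 1: "(\<Sum>x\<in>V. \<Sum>u\<in>V. w x u * (z u)\<^sup>2) = (\<Sum>x\<in>V. \<Sum>u\<in>V. w x u * (z x)\<^sup>2)"
    by (simp add: sum_distrib_right)
  have 2: "(\<Sum>x\<in>V. \<Sum>u\<in>V. w x u * (z x - z u)\<^sup>2)
      = 2 * (\<Sum>x\<in>V. \<Sum>u\<in>V. w x u * z x * (z x - z u))"
  proof -
    have "(\<Sum>x\<in>V. \<Sum>u\<in>V. w x u * (z x - z u)\<^sup>2)
        = (\<Sum>x\<in>V. \<Sum>u\<in>V. 2 * (w x u * z x * (z x - z u)) + (w x u * (z u)\<^sup>2 - w x u * (z x)\<^sup>2))"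
      by (simp add: power2_eq_square algebra_simps)
    also have "\<dots> = 2 * (\<Sum>x\<in>V. \<Sum>u\<in>V. w x u * z x * (z x - z u))
        + ((\<Sum>x\<in>V. \<Sum>u\<in>V. w x u * (z u)\<^sup>2) - (\<Sum>x\<in>V. \<Sum>u\<in>V. w x u * (z x)\<^sup>2))"
      unfolding sum.distrib sum_subtractf sum_distrib_left[symmetric] ..
    finally show ?thesis using 1 by simp
  qed
  have 3: "(\<Sum>x\<in>V. \<Sum>u\<in>V. w u x * (z x - z u)\<^sup>2) = (\<Sum>x\<in>V. \<Sum>u\<in>V. w x u * (z x - z u)\<^sup>2)"
    by (subst sum.swap) (simp add: power2_commute)
  have "(\<Sum>x\<in>V. \<Sum>u\<in>V. (w x u + w u x) * (z x - z u)\<^sup>2)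
      = (\<Sum>x\<in>V. \<Sum>u\<in>V. w x u * (z x - z u)\<^sup>2) + (\<Sum>x\<in>V. \<Sum>u\<in>V. w u x * (z x - z u)\<^sup>2)"
    by (simp add: distrib_right sum.distrib)
  then show ?thesis unfolding 3 2 by simp
qed

lemma qform_eulerian_orientation:
  assumes bij: "bij_betw v {..<n} A" and V: "V = insert r A" "r \<notin> A" "finite A" and z: "z r = 0"
    and m: "eulerian_orientation V e m"
  shows "qform n (reduced_laplacian V (\<lambda>x u. real (m x u)) v) (\<lambda>i. z (v i))
    = (\<Sum>x\<in>V. \<Sum>u\<in>V. real (e x u) * (z x - z u)\<^sup>2) / 4"
proof -
  have "finite V" using V by simp
  have or: "real (e x u) = real (m x u) + real (m u x)" for x u
    using m by (simp add: eulerian_orientation_def orientation_def flip: of_nat_add)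
  have "(\<Sum>u\<in>V. real (m u x)) = (\<Sum>u\<in>V. real (m x u))" if "x \<in> V" for x
    using m that eulerian_multi_digraph_iff[OF \<open>finite V\<close>, of m]
    by (simp add: eulerian_orientation_def flip: of_nat_sum)
  then show ?thesis
    unfolding qform_reduced_laplacian[where z = z, OF bij V z] or by (rule balanced_laplacian_form)
qed

text \<open>
  If the sum vanishes, then \<open>z\<close> is constant along edges, hence constant.
\<close>

lemma connected_dirichlet_form_pos:
  assumes "finite V" and conn: "connected_multigraph V e"
    and edges: "\<And>x u. e x u \<noteq> 0 \<Longrightarrow> x \<in> V \<and> u \<in> V"
    and xy: "x \<in> V" "y \<in> V" "z x \<noteq> z y"
  shows "0 < (\<Sum>x\<in>V. \<Sum>u\<in>V. real (e x u) * (z x - z u)\<^sup>2 :: real)" (is "0 < ?S")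
proof (rule ccontr)
  assume "\<not> 0 < ?S"
  moreover have "0 \<le> ?S" by (intro sum_nonneg) auto
  ultimately have "?S = 0" by linarith
  then have "\<forall>x\<in>V. (\<Sum>u\<in>V. real (e x u) * (z x - z u)\<^sup>2) = 0"
    by (subst (asm) sum_nonneg_eq_0_iff) (auto intro: sum_nonneg simp: \<open>finite V\<close>)
  then have zero: "real (e x u) * (z x - z u)\<^sup>2 = 0" if "x \<in> V" "u \<in> V" for x u
    using that sum_nonneg_eq_0_iff[OF \<open>finite V\<close>, of "\<lambda>u. real (e x u) * (z x - z u)\<^sup>2"] by auto
  have edge: "z a = z b" if "e a b \<noteq> 0" for a b
    using zero[of a b] edges[OF that] that by auto
  have "(x, y) \<in> {(a, b). e a b \<noteq> 0}\<^sup>*"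
    using conn xy by (auto simp: connected_multigraph_def)
  then have "z x = z y"
  proof (induction rule: rtrancl_induct)
    case (step a b)
    with edge[of a b] show ?case by simp
  qed simp
  with xy show False by simp
qed

lemma symmetric_orientation_eulerian:
  assumes "double_graph V e"
  shows "eulerian_orientation V e (symmetric_orientation e)"
proof -
  interpret double_graph V e by fact
  have "e u v div 2 + e v u div 2 = e u v" for u v
    using even_mult[of u v] mult_sym[of u v] by auto
  moreover have "(\<Sum>u\<in>V. e u x div 2) = (\<Sum>u\<in>V. e x u div 2)" for x
    by (simp only: mult_sym[of x])
  ultimately show ?thesis
    by (simp add: eulerian_orientation_def orientation_def eulerian_multi_digraph_iff[OF finite_vertices]
        symmetric_orientation_def)
qed

section \<open>Minimality of the symmetric orientation\<close>

lemma arb_eq_fdet: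
  assumes bij: "bij_betw v {..<n} A" and V: "V = insert r A" "r \<notin> A" "finite A"
  shows "real (arb_rooted (multi_digraph V m) r) = fdet n (reduced_laplacian V (\<lambda>x u. real (m x u)) v)"
  unfolding arb_rooted_eq_sum[OF V]
  using V by (subst matrix_tree[OF bij]) auto

text \<open>
  The off-diagonal entries give \<open>m\<close> on pairs of non-root vertices, and the diagonal entries are the
  out-degrees, which then determine the arcs into the root. The arcs out of the root are
  what is left of the edges at the root.
\<close>

lemma orientation_eqI_reduced_laplacian:
  assumes bij: "bij_betw v {..<n} A" and V: "V = insert r A" "r \<notin> A" "finite A"
    and G: "multigraph V e" and or: "orientation e m" "orientation e m'"
    and eq: "\<And>i j. i < n \<Longrightarrow> j < n \<Longrightarrow>
      reduced_laplacian V (\<lambda>x u. real (m x u)) v i j = reduced_laplacian V (\<lambda>x u. real (m' x u)) v i j"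
  shows "m = m'"
proof -
  interpret multigraph V e by fact
  have or': "m x u + m u x = e x u" "m' x u + m' u x = e x u" for x u
    using or by (auto simp: orientation_def)
  have diag: "m x x = 0" "m' x x = 0" for x
    using or'[of x x] no_loops[of x] by auto
  have A: "m x u = m' x u" if x: "x \<in> A" and u: "u \<in> A" for x u
  proof (cases "x = u")
    case False
    from x u obtain i j where "i < n" "j < n" "x = v i" "u = v j"
      using bij by (auto simp: bij_betw_def)
    moreover from this False have "i \<noteq> j" by auto
    ultimately show ?thesis using eq[of i j] by (auto simp: reduced_laplacian_def)
  qed (simp add: diag)
  have Ar: "m x r = m' x r" if x: "x \<in> A" for x
  proof -
    from x obtain i where "i < n" "x = v i" using bij by (auto simp: bij_betw_def)
    with eq[of i i] have "(\<Sum>u\<in>V. real (m x u)) = (\<Sum>u\<in>V. real (m' x u))"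
      by (simp add: reduced_laplacian_def diag)
    moreover have "(\<Sum>u\<in>A. real (m x u)) = (\<Sum>u\<in>A. real (m' x u))"
      using A[OF x] by simp
    ultimately show ?thesis using V by simp
  qed
  have rA: "m r x = m' r x" if x: "x \<in> A" for x
    using or'[of x r] Ar[OF x] by simp
  have out: "m x u = m' x u" if "x \<notin> V \<or> u \<notin> V" for x u
  proof -
    have "e x u = 0" using that edge_in_vertices[of x u] edge_in_vertices[of u x] mult_sym[of x u] by auto
    with or'[of x u] show ?thesis by simp
  qed
  have "m x u = m' x u" for x u
    using A Ar rA out diag V(1) by (cases "x \<in> V \<and> u \<in> V") auto
  then show ?thesis by blast
qed

text \<open>
  Both orientations have the same quadratic form, so \<open>fdet_mono_qform\<close> applies with the inequality
  of forms being an equality.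
\<close>

lemma symmetric_orientation_minimizes_arb:
  assumes G: "double_graph V e" and conn: "connected_multigraph V e"
    and m: "eulerian_orientation V e m"
  shows "arb (multi_digraph V (symmetric_orientation e)) \<le> arb (multi_digraph V m)"
    and "arb (multi_digraph V m) = arb (multi_digraph V (symmetric_orientation e))
      \<Longrightarrow> m = symmetric_orientation e"
proof -
  interpret double_graph V e by fact
  let ?s = "symmetric_orientation e"
  define r where "r = (SOME r. r \<in> V)"
  have "r \<in> V"
    using conn someI_ex[of "\<lambda>r. r \<in> V"] by (auto simp: r_def connected_multigraph_def)
  define A where "A = V - {r}"
  have V: "V = insert r A" "r \<notin> A" "finite A"
    using \<open>r \<in> V\<close> finite_vertices by (auto simp: A_def)
  obtain v :: "nat \<Rightarrow> 'a" and n where bij: "bij_betw v {..<n} A"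
    using ex_bij_betw_nat_finite[OF V(3)] by (auto simp: lessThan_atLeast0)
  define L where "L m = reduced_laplacian V (\<lambda>x u. real (m x u)) v" for m :: "'a \<Rightarrow> 'a \<Rightarrow> nat"
  have arb: "real (arb (multi_digraph V m)) = fdet n (L m)" for m
    unfolding arb_def verts_multi_digraph r_def[symmetric] L_def by (rule arb_eq_fdet[OF bij V])
  \<comment> \<open>the vector \<open>y\<close> transported to the vertices, with value 0 at the root\<close>
  define z where "z y x = (if x \<in> A then y (inv_into {..<n} v x) else 0)" for y :: "nat \<Rightarrow> real" and x
  have zr: "z y r = 0" for y by (simp add: z_def V(2))
  have zv: "z y (v i) = y i" if "i < n" for y i
    using bij that by (auto simp: z_def bij_betw_def)
  have q: "qform n (L m) y = (\<Sum>x\<in>V. \<Sum>u\<in>V. real (e x u) * (z y x - z y u)\<^sup>2) / 4"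
    if "eulerian_orientation V e m" for m y
  proof -
    have "qform n (L m) y = qform n (L m) (\<lambda>i. z y (v i))"
      by (rule qform_cong) (simp_all add: zv)
    then show ?thesis
      unfolding L_def using qform_eulerian_orientation[where z = "z y", OF bij V zr that] by simp
  qed
  note s = symmetric_orientation_eulerian[OF G]
  have key: "0 < fdet n (L ?s) \<and> fdet n (L ?s) \<le> fdet n (L m)
    \<and> (fdet n (L m) = fdet n (L ?s) \<longrightarrow> (\<forall>i<n. \<forall>j<n. L m i j = L ?s i j))"
  proof (rule fdet_mono_qform)
    show "L ?s i j = L ?s j i" for i j
      by (simp add: L_def reduced_laplacian_def symmetric_orientation_def mult_sym[of "v i"])
    show "qform n (L ?s) y \<le> qform n (L m) y" for y
      by (simp add: q[OF s] q[OF m])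
    fix y :: "nat \<Rightarrow> real" assume "\<exists>i<n. y i \<noteq> 0"
    then obtain i where i: "i < n" "y i \<noteq> 0" by blast
    have "v i \<in> V" using bij i V(1) by (auto simp: bij_betw_def)
    have "0 < (\<Sum>x\<in>V. \<Sum>u\<in>V. real (e x u) * (z y x - z y u)\<^sup>2)"
    proof (rule connected_dirichlet_form_pos[OF finite_vertices conn])
      show "x \<in> V \<and> u \<in> V" if "e x u \<noteq> 0" for x u
        using that edge_in_vertices[of x u] edge_in_vertices[of u x] mult_sym[of x u] by auto
      show "z y (v i) \<noteq> z y r" using i by (simp add: zv zr)
    qed (use \<open>v i \<in> V\<close> \<open>r \<in> V\<close> in auto)
    then show "0 < qform n (L ?s) y" by (simp add: q[OF s])
  qed
  from key show "arb (multi_digraph V ?s) \<le> arb (multi_digraph V m)"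
    by (simp flip: arb)
  assume "arb (multi_digraph V m) = arb (multi_digraph V ?s)"
  with key have "\<forall>i<n. \<forall>j<n. L m i j = L ?s i j"
    by (simp flip: arb)
  then show "m = ?s"
    using m s unfolding L_def eulerian_orientation_def
    by (intro orientation_eqI_reduced_laplacian[OF bij V multigraph_axioms]) auto
qed

theorem theorem1p13:
  fixes V :: "'v set" and e :: "'v \<Rightarrow> 'v \<Rightarrow> nat"
  assumes "double_graph V e" and "connected_multigraph V e"
  shows "{m. is_arg_min (\<lambda>m. arb (multi_digraph V m)) (eulerian_orientation V e) m}
           = {symmetric_orientation e}"
proof -
  note s = symmetric_orientation_eulerian[OF assms(1)]
  note min = symmetric_orientation_minimizes_arb[OF assms]
  let ?s = "symmetric_orientation e" and ?arb = "\<lambda>m. arb (multi_digraph V m)"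
  have "is_arg_min ?arb (eulerian_orientation V e) m \<longleftrightarrow> m = ?s" for m
  proof
    assume "is_arg_min ?arb (eulerian_orientation V e) m"
    then have m: "eulerian_orientation V e m" and "\<not> ?arb ?s < ?arb m"
      using s unfolding is_arg_min_def by blast+
    then have "?arb m = ?arb ?s" using min(1)[OF m] by linarith
    then show "m = ?s" by (rule min(2)[OF m])
  next
    assume "m = ?s"
    moreover have "\<not> ?arb m' < ?arb ?s" if "eulerian_orientation V e m'" for m'
      using min(1)[OF that] by linarith
    ultimately show "is_arg_min ?arb (eulerian_orientation V e) m"
      using s unfolding is_arg_min_def by blast
  qed
  then show ?thesis by blast
qed

end
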